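(* Every 2-free Fibonacci sequence $(a_k)_{k\ge 1}$ eventually turns into a cycle of length 1 consisting of an odd number: there exist an odd integer $x$ and an index $K$ such that $a_k = x$ for all $k \ge K$.
   Context: A 2-free Fibonacci sequence is a sequence $a_1,a_2,a_3,\dots$ whose two initial terms $a_1,a_2$ are nonnegative integers, not both zero, and for $k\ge 3$, $a_k=(a_{k-1}+a_{k-2})/2^{i}$, where $2^{i}$ ($i\ge 0$) is the largest power of $2$ dividing $a_{k-1}+a_{k-2}$. *)

theory Defs
  imports "HOL-Computational_Algebra.Primes"
begin

(* Sequences are indexed from 1; the value a 0 is unconstrained.
   2 ^ multiplicity 2 n is the largest power of 2 dividing n for n > 0,
   and the division by it is exact.  The sums occurring here are never 0. *)
definition two_free_fibonacci :: "(nat \<Rightarrow> nat) \<Rightarrow> bool" where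
  "two_free_fibonacci a \<longleftrightarrow>
     \<not> (a 1 = 0 \<and> a 2 = 0) \<and>
     (\<forall>k\<ge>3. a k = (a (k - 1) + a (k - 2)) div 2 ^ multiplicity 2 (a (k - 1) + a (k - 2)))"

end

theory Submission
  imports Defs
begin

text \<open>
  From the third term on, every term of a 2-free Fibonacci sequence is odd, being what is left
  of a positive number once all factors 2 are removed. The sum of two such terms is even, so
  at least one factor 2 is then removed in every step, and each new term is at most the mean of
  its two predecessors (\<open>odd_part_of_sum_le_mean\<close>). Hence the maximum of two neighbouring
  terms never increases, and as a natural number it reaches a least value \<open>M\<close>.
  After that no term can be smaller than \<open>M\<close>: such a term would enter the next mean and,
  through it, the one after that, so that two neighbours would both lie below \<open>M\<close>
  (\<open>sub_mean_sequence_eventually_constant\<close>). So the sequence is eventually constant,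
  and its value is odd because the terms are.
\<close>

lemma odd_div_power_multiplicity_two:
  fixes n :: nat
  assumes "n > 0"
  shows "odd (n div 2 ^ multiplicity 2 n)"
  using assms by (intro multiplicity_decompose) auto

lemma odd_part_of_sum_le_mean:
  fixes m n :: nat
  assumes "odd m" "odd n"
  shows "2 * ((m + n) div 2 ^ multiplicity 2 (m + n)) \<le> m + n"
proof -
  let ?e = "multiplicity 2 (m + n)"
  have "m + n \<noteq> 0"
    using assms(1) by (auto intro: Nat.gr0I)
  then have "?e \<ge> 1"
    using assms by (intro multiplicity_geI) auto
  then have "(2::nat) \<le> 2 ^ ?e"
    using power_increasing[of 1 ?e "2::nat"] by simp
  then have "2 * ((m + n) div 2 ^ ?e) \<le> 2 ^ ?e * ((m + n) div 2 ^ ?e)"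
    by (rule mult_le_mono1)
  also have "\<dots> \<le> m + n"
    by (rule times_div_less_eq_dividend)
  finally show ?thesis .
qed

text \<open>
  The maximum of two neighbours cannot increase, and it stays at its least value \<open>M\<close> only
  if no term is below \<open>M\<close>, since one smaller term pulls the next two means below
  \<open>M\<close>. The values being natural numbers is what makes the least value attained: over the
  reals the sequence would only converge.
\<close>

lemma sub_mean_sequence_eventually_constant:
  fixes b :: "nat \<Rightarrow> nat"
  assumes mean: "\<And>k. 2 * b (k + 2) \<le> b k + b (k + 1)"
  shows "\<exists>x N. \<forall>k\<ge>N. b k = x"
proof -
  define M where "M = (LEAST m. \<exists>k. max (b k) (b (k + 1)) = m)"
  obtain N where N: "max (b N) (b (N + 1)) = M"
    using LeastI_ex[of "\<lambda>m. \<exists>k. max (b k) (b (k + 1)) = m"] unfolding M_def by auto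
  have least: "M \<le> max (b k) (b (k + 1))" for k
    unfolding M_def by (rule Least_le) auto
  have upper: "b k \<le> M \<and> b (k + 1) \<le> M" if "k \<ge> N" for k
    using that
  proof (induction k rule: dec_induct)
    case base
    show ?case using N by auto
  next
    case (step k)
    then show ?case using mean[of k] by auto
  qed
  have "b k = M" if "k \<ge> N" for k
  proof (rule antisym)
    show "b k \<le> M" using upper[OF that] by simp
    show "M \<le> b k"
    proof (rule ccontr)
      assume "\<not> M \<le> b k"
      then have "b (k + 2) < M"
        using upper[OF that] mean[of k] by linarith
      moreover from this have "b (k + 3) < M"
        using upper[OF that] mean[of "k + 1"] by (simp add: eval_nat_numeral)
      ultimately show False
        using least[of "k + 2"] by (simp add: eval_nat_numeral)
    qed
  qed
  then show ?thesis by blast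
qed

theorem lemma1:
  fixes a :: "nat \<Rightarrow> nat"
  assumes "two_free_fibonacci a"
  shows "\<exists>x K. odd x \<and> K \<ge> 1 \<and> (\<forall>k\<ge>K. a k = x)"
proof -
  have init: "a 1 + a 2 > 0"
    using assms unfolding two_free_fibonacci_def by auto
  have rec: "a (k + 2) = (a (k + 1) + a k) div 2 ^ multiplicity 2 (a (k + 1) + a k)"
    if "k \<ge> 1" for k
    using assms that unfolding two_free_fibonacci_def by (auto dest!: spec[of _ "k + 2"])
  \<comment> \<open>Oddness is carried along with positivity of the sums: the first two terms may be even,
    and one of them may be 0.\<close>
  have odd_and_pos: "odd (a (k + 2)) \<and> a (k + 1) + a k > 0" if "k \<ge> 1" for k
    using that
  proof (induction k rule: dec_induct)
    case base
    show ?case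
      using init rec[of 1] odd_div_power_multiplicity_two[of "a 2 + a 1"]
      by (auto simp: eval_nat_numeral)
  next
    case (step k)
    have pos: "a (k + 2) + a (k + 1) > 0"
      using step.IH by (auto intro: Nat.gr0I)
    then show ?case
      using rec[of "k + 1"] odd_div_power_multiplicity_two[OF pos]
      by (simp add: eval_nat_numeral)
  qed
  have odd_term: "odd (a (k + 3))" for k
    using odd_and_pos[of "k + 1"] by (simp add: eval_nat_numeral)
  have "2 * a ((k + 2) + 3) \<le> a (k + 3) + a ((k + 1) + 3)" for k
    using rec[of "k + 3"] odd_part_of_sum_le_mean[OF odd_term[of "k + 1"] odd_term[of k]]
    by (simp add: eval_nat_numeral)
  then obtain x N where const: "\<And>k. k \<ge> N \<Longrightarrow> a (k + 3) = x"
    using sub_mean_sequence_eventually_constant[of "\<lambda>k. a (k + 3)"] by blast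
  have "a k = x" if "k \<ge> N + 3" for k
    using const[of "k - 3"] that by simp
  moreover have "odd x"
    using odd_term[of N] const[of N] by simp
  ultimately show ?thesis
    by (intro exI[of _ x] exI[of _ "N + 3"]) simp
qed

end
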